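(* For every integer $d\ge 1$ and every real $\varepsilon\in(0,1]$ there exists a number $g(\varepsilon,d)$, depending only on $\varepsilon$ and $d$, such that every finite set $P\subset\mathbb{R}^d$ admits a one-sided $\varepsilon$-approximant (with respect to convex sets) $A$ of size $\lvert A\rvert\le g(\varepsilon,d)$.
   Context: Let $P\subset\mathbb{R}^d$ be a finite set. A finite multiset $A$ of points of $\mathbb{R}^d$ is a one-sided $\varepsilon$-approximant for $P$ with respect to convex sets if $\frac{|C\cap P|}{|P|}-\frac{|C\cap A|}{|A|}\le\varepsilon$ for every convex set $C\subseteq\mathbb{R}^d$, where $|A|$ and $|C\cap A|$ are counted with multiplicity. The points of $A$ need not belong to $P$. *)

theory Defs
  imports "HOL-Analysis.Analysis" "HOL-Library.Multiset"
begin

(* A \<noteq> {#} is implicit in the quotient |C \<inter> A| / |A|.  Without it the convention x / 0 = 0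
   would make {#} an approximant for \<epsilon> = 1.  For P = {} the same convention makes the first
   quotient 0. *)
definition one_sided_approximant ::
  "real \<Rightarrow> (real ^ 'n) set \<Rightarrow> (real ^ 'n) multiset \<Rightarrow> bool" where
  "one_sided_approximant \<epsilon> P A \<longleftrightarrow>
     A \<noteq> {#} \<and>
     (\<forall>C. convex C \<longrightarrow>
        real (card (C \<inter> P)) / real (card P)
          - real (size {#x \<in># A. x \<in> C#}) / real (size A) \<le> \<epsilon>)"

end

theory Submission
  imports Defs "HOL-Real_Asymp.Real_Asymp"
begin

text \<open>
  \<^emph>\<open>Cutting.\<close> View points as vectors and half-spaces as linear functionals.  For a
  finite sample, every functional is a positive combination of at most \<open>d + 1\<close> extreme rays with
  compatible signs on the sample, and each ray is determined by at most \<open>d + 1\<close> sample points.  For a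
  random sample of bounded size, two sign-compatible rays have opposite signs on few points of the
  whole set.  Colouring each point by the signs of all rays therefore gives boundedly many classes such
  that every half-space splits classes of small total weight only.

  \<^emph>\<open>Stabbing.\<close> Let \<open>a\<close> be a centerpoint.  If a convex set \<open>C\<close> misses \<open>a\<close>, some half-space disjoint
  from \<open>C\<close> contains at least a fraction \<open>1 / (d + 1)\<close> of the points, hence almost as many in unsplit classes,
  so \<open>C\<close> misses a fixed proportion \<open>\<delta>\<close> of the set in whole classes.

  \<^emph>\<open>Energy increment.\<close> Iterate the partition for \<open>s\<close> levels and collect the centerpoints of all parts, weighted
  by size.  If \<open>C\<close> has density at least \<open>\<epsilon>\<close> in a part but misses its centerpoint, then refining that part
  increases the mean square density of \<open>C\<close> by a definite amount.  As the mean square density is at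
  most \<open>1\<close>, on average over the levels this happens only on a small part of the set.
\<close>

section \<open>Decomposition into extreme rays\<close>

text \<open>\<open>g\<close> lies in the closure of the cell of \<open>h\<close> in the arrangement
  of hyperplanes dual to \<open>X\<close>: a strict sign may degenerate to 0 but never flips, and a
  zero stays a zero.\<close>

definition sign_compat :: "'a::euclidean_space set \<Rightarrow> 'a \<Rightarrow> 'a \<Rightarrow> bool" where
  "sign_compat X h g \<longleftrightarrow>
     (\<forall>x\<in>X. (0 \<le> h \<bullet> x \<longrightarrow> 0 \<le> g \<bullet> x) \<and> (h \<bullet> x \<le> 0 \<longrightarrow> g \<bullet> x \<le> 0))"

definition zeros :: "'a::euclidean_space set \<Rightarrow> 'a \<Rightarrow> 'a set" where
  "zeros X h = {x \<in> X. h \<bullet> x = 0}"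

definition normal_to :: "'a::euclidean_space set \<Rightarrow> 'a" where
  "normal_to B = (SOME u. u \<noteq> 0 \<and> (\<forall>x\<in>B. u \<bullet> x = 0))"

text \<open>
  The extreme rays of the cones of functionals with prescribed weak signs on \<open>X\<close> are, up to positive
  scaling, among these vectors.  The set may contain arbitrary further vectors, namely the junk
  values of \<open>normal_to B\<close> when \<open>B\<close> is spanning or does not determine its normal.
\<close>

definition rays :: "'a::euclidean_space set \<Rightarrow> 'a set" where
  "rays X = (\<Union>B\<in>{B. B \<subseteq> X \<and> finite B \<and> card B \<le> DIM('a)}. {normal_to B, - normal_to B})"

lemma sign_compat_trans: "sign_compat X h g \<Longrightarrow> sign_compat X g k \<Longrightarrow> sign_compat X h k"
  by (simp add: sign_compat_def)

lemma sign_compat_zeros: "sign_compat X h g \<Longrightarrow> x \<in> X \<Longrightarrow> h \<bullet> x = 0 \<Longrightarrow> g \<bullet> x = 0"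
  by (force simp: sign_compat_def)

lemma zeros_subset: "zeros X h \<subseteq> X"
  by (auto simp: zeros_def)

lemma orthogonal_to_span:
  assumes "\<And>x. x \<in> Z \<Longrightarrow> u \<bullet> x = 0" "y \<in> span Z"
  shows "u \<bullet> y = 0"
proof -
  have "span Z \<subseteq> {x. u \<bullet> x = 0}"
    using assms(1) by (intro span_minimal subspace_hyperplane) auto
  then show ?thesis using assms(2) by auto
qed

text \<open>Move from \<open>h\<close> in direction \<open>u\<close> until a point of
  \<open>X\<close> first reaches value 0. Only points where \<open>h\<close> and \<open>u\<close>
  have opposite signs approach 0, and \<open>t\<close> is the least of their hitting times, so no
  sign flips. The point \<open>z\<close> reaching 0 lies outside the span of the old zeros, since
  \<open>u\<close> vanishes there but not at \<open>z\<close>; hence the rank of the zero set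
  grows.\<close>

lemma slide:
  fixes h u :: "'a::euclidean_space"
  assumes fin: "finite X" and orth: "\<And>x. x \<in> X \<Longrightarrow> h \<bullet> x = 0 \<Longrightarrow> u \<bullet> x = 0"
    and y: "y \<in> X" "(h \<bullet> y) * (u \<bullet> y) < 0"
  obtains t z where "t > 0" "sign_compat X h (h + t *\<^sub>R u)"
    "dim (zeros X h) < dim (zeros X (h + t *\<^sub>R u))"
    "z \<in> X" "(h + t *\<^sub>R u) \<bullet> z = 0" "u \<bullet> z \<noteq> 0"
proof -
  define S where "S = {x \<in> X. (h \<bullet> x) * (u \<bullet> x) < 0}"
  define q where "q = (\<lambda>x. - (h \<bullet> x) / (u \<bullet> x))"
  define t where "t = Min (q ` S)"
  have S: "finite (q ` S)" "q ` S \<noteq> {}" using fin y by (auto simp: S_def)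
  obtain z where z: "z \<in> S" "t = q z" using Min_in[OF S] by (auto simp: t_def)
  have qpos: "q x > 0" if "x \<in> S" for x
    using that by (auto simp: S_def q_def mult_less_0_iff divide_less_0_iff)
  have tle: "t \<le> q x" if "x \<in> S" for x using S that by (simp add: t_def)
  have tpos: "t > 0" using z qpos by simp
  have zX: "z \<in> X" and uz: "u \<bullet> z \<noteq> 0" using z by (auto simp: S_def)
  have gz: "(h + t *\<^sub>R u) \<bullet> z = 0" using uz by (simp only: z(2) q_def inner_add_left inner_scaleR_left) simp
  have compat: "sign_compat X h (h + t *\<^sub>R u)"
    unfolding sign_compat_def
  proof (intro ballI)
    fix x assume x: "x \<in> X"
    consider "h \<bullet> x = 0" | "h \<bullet> x > 0" "u \<bullet> x < 0" | "h \<bullet> x > 0" "u \<bullet> x \<ge> 0"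
      | "h \<bullet> x < 0" "u \<bullet> x > 0" | "h \<bullet> x < 0" "u \<bullet> x \<le> 0" by linarith
    then show "(0 \<le> h \<bullet> x \<longrightarrow> 0 \<le> (h + t *\<^sub>R u) \<bullet> x) \<and> (h \<bullet> x \<le> 0 \<longrightarrow> (h + t *\<^sub>R u) \<bullet> x \<le> 0)"
    proof cases
      case 1 then show ?thesis using orth[OF x] by (simp add: inner_add_left)
    next
      case 2
      then have "x \<in> S" using x by (simp add: S_def mult_less_0_iff)
      from tle[OF this] 2 show ?thesis
        by (simp add: inner_add_left q_def field_simps)
    next
      case 3
      then have "t * (u \<bullet> x) \<ge> 0" using tpos by simp
      then show ?thesis using 3 by (simp add: inner_add_left)
    next
      case 4
      then have "x \<in> S" using x by (simp add: S_def mult_less_0_iff)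
      from tle[OF this] 4 show ?thesis
        by (simp add: inner_add_left q_def field_simps)
    next
      case 5
      then have "t * (u \<bullet> x) \<le> 0" using tpos by (simp add: mult_le_0_iff)
      then show ?thesis using 5 by (simp add: inner_add_left)
    qed
  qed
  have "z \<notin> span (zeros X h)"
    using orthogonal_to_span[of "zeros X h" u z] orth uz by (auto simp: zeros_def)
  then have "dim (zeros X h) < dim (insert z (zeros X h))" by (simp add: dim_insert)
  also have "\<dots> \<le> dim (zeros X (h + t *\<^sub>R u))"
    using zX gz sign_compat_zeros[OF compat] by (intro dim_subset) (auto simp: zeros_def)
  finally show ?thesis using that tpos compat zX gz uz by blast
qed

lemma nonorthogonal_in_spanning:
  assumes "span X = UNIV" "u \<noteq> 0"
  obtains x where "x \<in> X" "u \<bullet> x \<noteq> 0"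
proof -
  have "u \<bullet> u \<noteq> 0" using assms by simp
  then show ?thesis using orthogonal_to_span[of X u u] assms that by blast
qed

text \<open>Induction on the corank of the zero set. While some functional vanishing on the zeros of
  \<open>h\<close> is not a multiple of \<open>h\<close>, sliding along it raises the rank.
  Otherwise the zeros determine \<open>h\<close> up to scaling, so \<open>h\<close> is proportional
  to the normal of a basis of their span.\<close>

lemma extreme_ray:
  fixes h :: "'a::euclidean_space"
  assumes fin: "finite X" and sp: "span X = UNIV"
  shows "h \<noteq> 0 \<Longrightarrow> \<exists>e\<in>rays X. e \<noteq> 0 \<and> sign_compat X h e"
proof (induction "DIM('a) - dim (zeros X h)" arbitrary: h rule: less_induct)
  case less
  show ?case
  proof (cases "\<exists>u. (\<forall>x\<in>zeros X h. u \<bullet> x = 0) \<and> u \<notin> span {h}")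
    case True
    then obtain u where u: "\<forall>x\<in>zeros X h. u \<bullet> x = 0" "u \<notin> span {h}" by blast
    have "u \<noteq> 0" using u span_0 by metis
    then obtain y where y: "y \<in> X" "u \<bullet> y \<noteq> 0" using nonorthogonal_in_spanning[OF sp] by blast
    then have hy: "h \<bullet> y \<noteq> 0" using u by (auto simp: zeros_def)
    obtain w where w: "w = u \<or> w = - u" "(h \<bullet> y) * (w \<bullet> y) < 0"
    proof (cases "(h \<bullet> y) * (u \<bullet> y) < 0")
      case False
      moreover have "(h \<bullet> y) * (u \<bullet> y) \<noteq> 0" using y hy by simp
      ultimately have "(h \<bullet> y) * ((-u) \<bullet> y) < 0" by (simp add: order_less_le)
      then show ?thesis using that by blast
    qed (use that in blast)
    have orth: "w \<bullet> x = 0" if "x \<in> X" "h \<bullet> x = 0" for x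
      using u w that by (auto simp: zeros_def)
    obtain t z where t: "t > 0" "sign_compat X h (h + t *\<^sub>R w)"
      "dim (zeros X h) < dim (zeros X (h + t *\<^sub>R w))"
      using slide[OF fin orth y(1) w(2)] by blast
    have "h + t *\<^sub>R w \<noteq> 0"
    proof
      assume *: "h + t *\<^sub>R w = 0"
      then have "t *\<^sub>R w = - h" by (simp add: add_eq_0_iff)
      then have "(1 / t) *\<^sub>R (t *\<^sub>R w) = (1 / t) *\<^sub>R (- h)" by simp
      then have "w = (- (1 / t)) *\<^sub>R h" using t(1) by simp
      then have "u = (- (1 / t)) *\<^sub>R h \<or> u = (1 / t) *\<^sub>R h" using w(1) by auto
      then have "u \<in> span {h}" by (metis span_base span_mul singletonI)
      with u show False by blast
    qed
    moreover have "DIM('a) - dim (zeros X (h + t *\<^sub>R w)) < DIM('a) - dim (zeros X h)"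
      using t(3) dim_subset_UNIV[of "zeros X (h + t *\<^sub>R w)"] by linarith
    ultimately obtain e where "e \<in> rays X" "e \<noteq> 0" "sign_compat X (h + t *\<^sub>R w) e"
      using less.hyps by blast
    then show ?thesis using sign_compat_trans[OF t(2)] by blast
  next
    case False
    obtain B where B: "B \<subseteq> zeros X h" "independent B" "zeros X h \<subseteq> span B"
      using maximal_independent_subset by blast
    have fB: "finite B" "card B \<le> DIM('a)" using independent_bound[OF B(2)] by auto
    have "h \<noteq> 0 \<and> (\<forall>x\<in>B. h \<bullet> x = 0)" using less.prems B(1) by (auto simp: zeros_def)
    then have n: "normal_to B \<noteq> 0" "\<forall>x\<in>B. normal_to B \<bullet> x = 0"
      using someI[of "\<lambda>u. u \<noteq> 0 \<and> (\<forall>x\<in>B. u \<bullet> x = 0)" h] unfolding normal_to_def by blast+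
    have "\<forall>x\<in>zeros X h. normal_to B \<bullet> x = 0"
      using orthogonal_to_span[of B "normal_to B"] n B(3) by blast
    then have "normal_to B \<in> span {h}" using False by blast
    then obtain c where c: "normal_to B = c *\<^sub>R h" by (auto simp: span_singleton)
    have "c \<noteq> 0" using c n by auto
    \<comment> \<open>The normal is picked by choice, so its orientation is arbitrary; this is why
      \<open>rays\<close> contains both signs.\<close>
    define e where "e = (if c > 0 then normal_to B else - normal_to B)"
    have e: "e = \<bar>c\<bar> *\<^sub>R h" using c by (auto simp: e_def)
    have "sign_compat X h e"
      by (auto simp: e sign_compat_def mult_nonneg_nonneg mult_nonneg_nonpos)
    moreover have "e \<in> rays X"
      using fB B(1) zeros_subset[of X h] by (auto simp: rays_def e_def)
    ultimately show ?thesis using e \<open>c \<noteq> 0\<close> less.prems by (intro bexI[of _ e]) auto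
  qed
qed

text \<open>Subtract from \<open>h\<close> the multiple of an extreme ray at which a further point
  of \<open>X\<close> becomes a zero. The remainder is still sign-compatible with \<open>h\<close>
  and its zero set has larger rank, so at most \<open>DIM('a) - dim (zeros X h)\<close> subtractions
  occur; the bound on \<open>card U\<close> is this invariant.\<close>

lemma ray_decomposition:
  fixes h :: "'a::euclidean_space"
  assumes fin: "finite X" and sp: "span X = UNIV"
  shows "\<exists>U l. finite U \<and> U \<subseteq> rays X \<and> card U + dim (zeros X h) \<le> DIM('a) \<and>
           (\<forall>u\<in>U. l u > (0::real) \<and> sign_compat X h u) \<and> h = (\<Sum>u\<in>U. l u *\<^sub>R u)"
proof (induction "DIM('a) - dim (zeros X h)" arbitrary: h rule: less_induct)
  case less
  show ?case
  proof (cases "h = 0")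
    case True
    then show ?thesis
      by (intro exI[of _ "{}"]) (auto simp: dim_subset_UNIV)
  next
    case False
    obtain e where e: "e \<in> rays X" "e \<noteq> 0" "sign_compat X h e"
      using extreme_ray[OF fin sp False] by blast
    obtain y where y: "y \<in> X" "e \<bullet> y \<noteq> 0" using nonorthogonal_in_spanning[OF sp e(2)] by blast
    have orth: "(- e) \<bullet> x = 0" if "x \<in> X" "h \<bullet> x = 0" for x
      using sign_compat_zeros[OF e(3)] that by simp
    have "(h \<bullet> y) * ((- e) \<bullet> y) < 0"
      using e(3) y unfolding sign_compat_def
      by (smt (verit) inner_minus_left mult_neg_pos mult_pos_neg)
    then obtain t z where t: "t > 0" "sign_compat X h (h + t *\<^sub>R (- e))"
      "dim (zeros X h) < dim (zeros X (h + t *\<^sub>R (- e)))"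
      "z \<in> X" "(h + t *\<^sub>R (- e)) \<bullet> z = 0" "(- e) \<bullet> z \<noteq> 0"
      using slide[OF fin orth y(1)] by blast
    define h' where "h' = h + t *\<^sub>R (- e)"
    have "DIM('a) - dim (zeros X h') < DIM('a) - dim (zeros X h)"
      using t(3) dim_subset_UNIV[of "zeros X h'"] unfolding h'_def by linarith
    from less.hyps[OF this] obtain U l where U: "finite U" "U \<subseteq> rays X"
      "card U + dim (zeros X h') \<le> DIM('a)"
      "\<forall>u\<in>U. l u > (0::real) \<and> sign_compat X h' u" "h' = (\<Sum>u\<in>U. l u *\<^sub>R u)" by blast
    \<comment> \<open>\<open>z\<close> is a zero of the remainder, so all rays of \<open>U\<close>
      vanish at it, while \<open>e\<close> does not.\<close>
    have "e \<notin> U"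
      using U(4) sign_compat_zeros[of X h' e z] t(4-6) by (auto simp: h'_def)
    define l' where "l' = l(e := t)"
    have "(\<Sum>u\<in>U. l' u *\<^sub>R u) = (\<Sum>u\<in>U. l u *\<^sub>R u)"
      using \<open>e \<notin> U\<close> by (intro sum.cong) (auto simp: l'_def)
    then have "h = (\<Sum>u\<in>insert e U. l' u *\<^sub>R u)"
      using U(1,5) \<open>e \<notin> U\<close> by (simp add: l'_def h'_def algebra_simps)
    moreover have "card (insert e U) + dim (zeros X h) \<le> DIM('a)"
      using U(1,3) t(3) \<open>e \<notin> U\<close> unfolding h'_def by simp
    moreover have "\<forall>u\<in>insert e U. l' u > 0 \<and> sign_compat X h u"
      using U(4) \<open>e \<notin> U\<close> t(1,2) e(3) sign_compat_trans unfolding h'_def l'_def by fastforce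
    ultimately show ?thesis using U(1,2) e(1)
      by (intro exI[of _ "insert e U"] exI[of _ l']) auto
  qed
qed

lemma rays_mono: "X \<subseteq> Y \<Longrightarrow> rays X \<subseteq> rays Y"
  unfolding rays_def by blast

lemma rays_finite_card:
  fixes X :: "'a::euclidean_space set"
  assumes "finite X"
  shows "finite (rays X)" "card (rays X) \<le> 2 * 2 ^ card X"
proof -
  let ?I = "{B. B \<subseteq> X \<and> finite B \<and> card B \<le> DIM('a)}"
  have I: "?I \<subseteq> Pow X" by auto
  have fI: "finite ?I" using I assms finite_subset by blast
  then show "finite (rays X)" by (simp add: rays_def)
  have "card (rays X) \<le> (\<Sum>B\<in>?I. card {normal_to B, - normal_to B})"
    unfolding rays_def by (rule card_UN_le[OF fI])
  also have "\<dots> \<le> (\<Sum>B\<in>?I. 2)" by (intro sum_mono) (simp add: card_insert_if)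
  also have "\<dots> \<le> 2 * card (Pow X)" using card_mono[OF _ I] assms by simp
  finally show "card (rays X) \<le> 2 * 2 ^ card X" using assms by (simp add: card_Pow)
qed

text \<open>A ray is given by at most \<open>DIM('a)\<close> vectors, so with \<open>E\<close> fixed
  it depends on few points of \<open>R\<close>. This lets the sampling argument index its events by
  small subsets of the sample.\<close>

lemma rays_localize:
  fixes R E :: "'a::euclidean_space set"
  assumes "u \<in> rays (R \<union> E)"
  obtains T where "T \<subseteq> R" "finite T" "card T \<le> DIM('a)" "u \<in> rays (T \<union> E)"
proof -
  obtain B where B: "B \<subseteq> R \<union> E" "finite B" "card B \<le> DIM('a)" "u = normal_to B \<or> u = - normal_to B"
    using assms unfolding rays_def by blast
  show ?thesis
  proof (rule that[of "B \<inter> R"])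
    show "card (B \<inter> R) \<le> DIM('a)" using B card_mono[of B "B \<inter> R"] by force
    show "u \<in> rays (B \<inter> R \<union> E)" using B unfolding rays_def by blast
  qed (use B in auto)
qed

section \<open>Random sampling\<close>

text \<open>The entries with index in \<open>J\<close> determine the set that \<open>D\<close>
  attaches to them, and each remaining entry must avoid this set, which leaves at most
  \<open>(1 - \<eta>) * card X\<close> choices for it.\<close>

lemma card_avoiding_tuples:
  fixes X :: "'a set" and D :: "'a set \<Rightarrow> 'a set" and \<eta> :: real
  assumes X: "finite X" and I: "finite I" "J \<subseteq> I"
    and \<eta>: "0 \<le> \<eta>" "\<eta> \<le> 1"
  shows "real (card {f \<in> PiE I (\<lambda>_. X). D (f ` J) \<subseteq> X \<and> real (card (D (f ` J))) > \<eta> * real (card X)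
            \<and> f ` I \<inter> D (f ` J) = {}})
     \<le> real (card X) ^ card I * (1 - \<eta>) ^ card (I - J)" (is "real (card ?bad) \<le> _")
proof -
  let ?U = "{u \<in> PiE J (\<lambda>_. X). D (u ` J) \<subseteq> X \<and> real (card (D (u ` J))) > \<eta> * real (card X)}"
  let ?S = "Sigma ?U (\<lambda>u. PiE (I - J) (\<lambda>_. X - D (u ` J)))"
  let ?g = "\<lambda>f. (restrict f J, restrict f (I - J))"
  have fJ: "finite J" using I finite_subset by blast
  have fPJ: "finite (PiE J (\<lambda>_. X))" using fJ X by (simp add: finite_PiE)
  have fU: "finite ?U" using fPJ by simp
  have fS: "finite ?S" using fU X I by (intro finite_SigmaI finite_PiE) auto
  have im: "restrict f J ` J = f ` J" for f :: "'b \<Rightarrow> 'a" by auto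
  have "inj_on ?g ?bad"
  proof (rule inj_onI)
    fix f g assume fg: "f \<in> ?bad" "g \<in> ?bad" "?g f = ?g g"
    show "f = g"
    proof
      fix x
      show "f x = g x"
      proof (cases "x \<in> I")
        case True
        then show ?thesis using fg(3) by (cases "x \<in> J") (auto dest: fun_cong[of _ _ x])
      next
        case False
        then show ?thesis using fg(1,2) by (auto simp: PiE_def extensional_def)
      qed
    qed
  qed
  moreover have "?g ` ?bad \<subseteq> ?S"
    using I(2) by (auto simp: im PiE_def Pi_def)
  ultimately have "card ?bad \<le> card ?S" by (rule card_inj_on_le[OF _ _ fS])
  also have "\<dots> = (\<Sum>u\<in>?U. card (PiE (I - J) (\<lambda>_. X - D (u ` J))))"
    using fU X I by (intro card_SigmaI) (auto intro!: finite_PiE)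
  also have "\<dots> = (\<Sum>u\<in>?U. card (X - D (u ` J)) ^ card (I - J))"
    using I by (simp add: card_PiE)
  finally have "real (card ?bad) \<le> (\<Sum>u\<in>?U. real (card (X - D (u ` J))) ^ card (I - J))"
    by (subst of_nat_power[symmetric], subst of_nat_sum[symmetric], subst of_nat_le_iff)
  also have "\<dots> \<le> (\<Sum>u\<in>?U. ((1 - \<eta>) * real (card X)) ^ card (I - J))"
  proof (intro sum_mono power_mono)
    fix u assume u: "u \<in> ?U"
    then have sub: "D (u ` J) \<subseteq> X" by blast
    then have "card (X - D (u ` J)) = card X - card (D (u ` J))"
      using X finite_subset by (intro card_Diff_subset) auto
    moreover have "card (D (u ` J)) \<le> card X" using sub X by (rule card_mono[rotated])
    ultimately have "real (card (X - D (u ` J))) = real (card X) - real (card (D (u ` J)))" by simp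
    then show "real (card (X - D (u ` J))) \<le> (1 - \<eta>) * real (card X)"
      using u by (simp add: algebra_simps)
  qed simp
  also have "\<dots> = real (card ?U) * ((1 - \<eta>) * real (card X)) ^ card (I - J)" by simp
  also have "\<dots> \<le> real (card X) ^ card J * ((1 - \<eta>) * real (card X)) ^ card (I - J)"
  proof (intro mult_right_mono)
    have "card ?U \<le> card (PiE J (\<lambda>_. X))" by (rule card_mono[OF fPJ]) auto
    also have "\<dots> = card X ^ card J" using fJ by (simp add: card_PiE)
    finally show "real (card ?U) \<le> real (card X) ^ card J"
      by (subst of_nat_power[symmetric], subst of_nat_le_iff)
  qed (use \<eta> in simp)
  also have "\<dots> = real (card X) ^ (card J + card (I - J)) * (1 - \<eta>) ^ card (I - J)"
    by (simp add: power_add power_mult_distrib)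
  also have "card J + card (I - J) = card I"
    using I card_Diff_subset[OF fJ I(2)] card_mono[OF I] by simp
  finally show ?thesis .
qed

lemma card_small_subsets_le:
  assumes "finite I" "card I \<ge> 1"
  shows "card {J. J \<subseteq> I \<and> card J \<le> k} \<le> Suc k * card I ^ k"
proof -
  have "{J. J \<subseteq> I \<and> card J \<le> k} = (\<Union>i\<in>{..k}. {J. J \<subseteq> I \<and> card J = i})" by auto
  then have "card {J. J \<subseteq> I \<and> card J \<le> k} \<le> (\<Sum>i\<le>k. card {J. J \<subseteq> I \<and> card J = i})"
    using card_UN_le[of "{..k}"] by simp
  also have "\<dots> = (\<Sum>i\<le>k. card I choose i)" using n_subsets[OF assms(1)] by simp
  also have "\<dots> \<le> (\<Sum>i\<le>k. card I ^ k)"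
  proof (intro sum_mono)
    fix i assume "i \<in> {..k}"
    then have "card I ^ i \<le> card I ^ k" using assms by (intro power_increasing) auto
    moreover have "card I choose i \<le> card I ^ i"
      by (cases "i \<le> card I") (auto intro: binomial_le_pow simp: binomial_eq_0)
    ultimately show "card I choose i \<le> card I ^ k" by linarith
  qed
  finally show ?thesis by simp
qed

lemma sample_size_exists:
  fixes \<eta> :: real
  assumes "0 < \<eta>" "\<eta> < 1"
  obtains m where "m \<ge> 1" "m \<ge> k" "real c * (real (Suc k) * real m ^ k) * (1 - \<eta>) ^ (m - k) < 1"
proof -
  \<comment> \<open>With \<open>m = n + k + 1\<close> the truncated difference \<open>m - k\<close>
    becomes \<open>n + 1\<close>; exponential decay then beats the polynomial factor.\<close>
  have "(\<lambda>n. real c * (real (Suc k) * real (n + k + 1) ^ k) * (1 - \<eta>) ^ (n + 1)) \<longlonglongrightarrow> 0"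
    using assms by real_asymp
  then have "\<forall>\<^sub>F n in sequentially. real c * (real (Suc k) * real (n + k + 1) ^ k) * (1 - \<eta>) ^ (n + 1) < 1"
    by (rule order_tendstoD) simp
  then obtain n where "real c * (real (Suc k) * real (n + k + 1) ^ k) * (1 - \<eta>) ^ (n + 1) < 1"
    by (meson eventually_happens trivial_limit_sequentially)
  then show ?thesis by (intro that[of "n + k + 1"]) auto
qed

text \<open>
  The sets \<open>\<D> T\<close> are attached to few sample points \<open>T\<close>, so the union bound runs over at most
  \<open>c (k + 1) m\<^sup>k\<close> events, each of probability at most \<open>(1 - \<eta>)\<close> to the power \<open>m - k\<close>.
\<close>

lemma sampling:
  fixes \<eta> :: real
  assumes \<eta>: "0 < \<eta>" "\<eta> < 1"
  shows "\<exists>m. \<forall>(X :: 'a set) (\<D> :: 'a set \<Rightarrow> 'a set set).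
     finite X \<longrightarrow> X \<noteq> {} \<longrightarrow>
     (\<forall>T. T \<subseteq> X \<longrightarrow> card T \<le> k \<longrightarrow> finite (\<D> T) \<and> card (\<D> T) \<le> c) \<longrightarrow>
     (\<exists>R\<subseteq>X. card R \<le> m \<and>
       (\<forall>T\<subseteq>R. card T \<le> k \<longrightarrow> (\<forall>D\<in>\<D> T. D \<subseteq> X \<longrightarrow> R \<inter> D = {} \<longrightarrow> real (card D) \<le> \<eta> * real (card X))))"
proof -
  obtain m where m: "m \<ge> 1" "m \<ge> k" "real c * (real (Suc k) * real m ^ k) * (1 - \<eta>) ^ (m - k) < 1"
    using sample_size_exists[OF \<eta>] by blast
  show ?thesis
  proof (intro exI[of _ m] allI impI)
    fix X :: "'a set" and \<D> :: "'a set \<Rightarrow> 'a set set"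
    assume X: "finite X" "X \<noteq> {}"
      and \<D>: "\<forall>T. T \<subseteq> X \<longrightarrow> card T \<le> k \<longrightarrow> finite (\<D> T) \<and> card (\<D> T) \<le> c"
    \<comment> \<open>Enumerating \<open>\<D> T\<close> by indices below \<open>c\<close> yields
      \<open>c\<close> functions of \<open>T\<close>, to each of which
      \<open>card_avoiding_tuples\<close> applies.\<close>
    have "\<exists>e. \<forall>D. D \<in> \<D> T \<longrightarrow> (\<exists>i<c. e i = D)" if "T \<subseteq> X" "card T \<le> k" for T
    proof -
      have *: "finite (\<D> T)" "card (\<D> T) \<le> c" using \<D> that by auto
      from ex_bij_betw_nat_finite[OF *(1)] obtain e where e: "bij_betw e {0..<card (\<D> T)} (\<D> T)" by blast
      have "\<exists>i<c. e i = D" if "D \<in> \<D> T" for D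
      proof -
        have "D \<in> e ` {0..<card (\<D> T)}" using e that by (simp add: bij_betw_def)
        then show ?thesis using *(2) by force
      qed
      then show ?thesis by blast
    qed
    then have "\<forall>T. \<exists>e. T \<subseteq> X \<longrightarrow> card T \<le> k \<longrightarrow> (\<forall>D. D \<in> \<D> T \<longrightarrow> (\<exists>i<c. e i = D))" by blast
    then obtain e where e: "\<And>T D. T \<subseteq> X \<Longrightarrow> card T \<le> k \<Longrightarrow> D \<in> \<D> T \<Longrightarrow> \<exists>i<c. e T i = D"
      by (metis (full_types))
    \<comment> \<open>The sample is an \<open>m\<close>-tuple drawn with repetition, so its entries
      are independent; \<open>R\<close> will be its set of values.\<close>
    let ?I = "{..<m}"
    let ?P = "PiE ?I (\<lambda>_. X)"
    let ?Js = "{J. J \<subseteq> ?I \<and> card J \<le> k}"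
    define bad where "bad = (\<lambda>(J, i). {f \<in> ?P. e (f ` J) i \<subseteq> X \<and>
       real (card (e (f ` J) i)) > \<eta> * real (card X) \<and> f ` ?I \<inter> e (f ` J) i = {}})"
    have fP: "finite ?P" using X by (simp add: finite_PiE)
    have fJs: "finite ?Js" by simp
    have "real (card (\<Union>z\<in>?Js \<times> {..<c}. bad z)) \<le> (\<Sum>z\<in>?Js \<times> {..<c}. real (card (bad z)))"
      using fJs by (subst of_nat_sum[symmetric], subst of_nat_le_iff) (intro card_UN_le finite_SigmaI finite_lessThan)
    also have "\<dots> \<le> (\<Sum>z\<in>?Js \<times> {..<c}. real (card X) ^ m * (1 - \<eta>) ^ (m - k))"
    proof (intro sum_mono)
      fix z assume z: "z \<in> ?Js \<times> {..<c}"
      obtain J i where zi: "z = (J, i)" by fastforce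
      then have J: "J \<subseteq> ?I" "card J \<le> k" using z by auto
      have "real (card (bad z)) \<le> real (card X) ^ m * (1 - \<eta>) ^ card (?I - J)"
        using card_avoiding_tuples[OF X(1) _ J(1), of \<eta> "\<lambda>T. e T i"] \<eta>
        by (simp add: bad_def zi)
      also have "\<dots> \<le> real (card X) ^ m * (1 - \<eta>) ^ (m - k)"
      proof (intro mult_left_mono power_decreasing)
        have "finite J" using J finite_subset by blast
        then show "m - k \<le> card (?I - J)"
          using J by (simp add: card_Diff_subset)
      qed (use \<eta> in auto)
      finally show "real (card (bad z)) \<le> real (card X) ^ m * (1 - \<eta>) ^ (m - k)" .
    qed
    also have "\<dots> = real (card ?Js) * real c * (real (card X) ^ m * (1 - \<eta>) ^ (m - k))"
      by (simp add: card_cartesian_product)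
    also have "\<dots> \<le> (real (Suc k) * real m ^ k) * real c * (real (card X) ^ m * (1 - \<eta>) ^ (m - k))"
    proof (intro mult_right_mono)
      have "card ?Js \<le> Suc k * m ^ k" using card_small_subsets_le[of ?I k] m(1) by simp
      then show "real (card ?Js) \<le> real (Suc k) * real m ^ k"
        by (subst of_nat_power[symmetric], subst of_nat_mult[symmetric], subst of_nat_le_iff)
    qed (use \<eta> in auto)
    also have "\<dots> = (real c * (real (Suc k) * real m ^ k) * (1 - \<eta>) ^ (m - k)) * real (card X) ^ m"
      by (simp add: algebra_simps)
    also have "\<dots> < 1 * real (card X) ^ m"
      using m(3) X by (intro mult_strict_right_mono) (auto simp: card_gt_0_iff)
    also have "\<dots> = real (card ?P)" by (simp add: card_PiE)
    finally have less: "card (\<Union>z\<in>?Js \<times> {..<c}. bad z) < card ?P" by simp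
    have fbad: "finite (\<Union>z\<in>?Js \<times> {..<c}. bad z)"
      by (rule finite_subset[OF _ fP]) (auto simp: bad_def)
    obtain f where f: "f \<in> ?P" "f \<notin> (\<Union>z\<in>?Js \<times> {..<c}. bad z)"
      using less card_mono[OF fbad, of ?P] by (meson not_le subsetI)
    show "\<exists>R\<subseteq>X. card R \<le> m \<and>
       (\<forall>T\<subseteq>R. card T \<le> k \<longrightarrow> (\<forall>D\<in>\<D> T. D \<subseteq> X \<longrightarrow> R \<inter> D = {} \<longrightarrow> real (card D) \<le> \<eta> * real (card X)))"
    proof (intro exI[of _ "f ` ?I"] conjI allI ballI impI)
      show sub: "f ` ?I \<subseteq> X" using f(1) by auto
      show "card (f ` ?I) \<le> m" using card_image_le[of ?I f] by simp
      fix T D assume T: "T \<subseteq> f ` ?I" "card T \<le> k" and D: "D \<in> \<D> T" "D \<subseteq> X" "f ` ?I \<inter> D = {}"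
      \<comment> \<open>One index is chosen for each element of \<open>T\<close>, so
        \<open>J\<close> is no larger than \<open>T\<close> and its events were counted.\<close>
      obtain J where J: "J \<subseteq> ?I" "T = f ` J" "inj_on f J"
        using T(1) subset_image_inj[of T f ?I] by blast
      have cJ: "card J \<le> k" using J T(2) by (simp add: card_image)
      have "T \<subseteq> X" using T(1) sub by blast
      then obtain i where i: "i < c" "e T i = D" using e T(2) D(1) by blast
      have "f \<notin> bad (J, i)" using f(2) J(1) cJ i(1) by blast
      then show "real (card D) \<le> \<eta> * real (card X)"
        using f(1) D i(2) J(2) by (auto simp: bad_def not_less)
    qed
  qed
qed

section \<open>Cuttings\<close>

text \<open>No two of the values \<open>a u\<close> have strictly opposite signs, so nothing cancels
  in the sum, and the values \<open>b u\<close> have the same signs. Used in contraposition: a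
  functional that distinguishes two points of one class has two rays in conflict.\<close>

lemma sgn_positive_combination:
  fixes l a b :: "'i \<Rightarrow> real"
  assumes U: "finite U" and l: "\<And>u. u \<in> U \<Longrightarrow> 0 < l u"
    and sgn: "\<And>u. u \<in> U \<Longrightarrow> sgn (a u) = sgn (b u)"
    and no: "\<And>u v. u \<in> U \<Longrightarrow> v \<in> U \<Longrightarrow> \<not> (0 < a u \<and> a v < 0)"
  shows "sgn (\<Sum>u\<in>U. l u * a u) = sgn (\<Sum>u\<in>U. l u * b u)"
proof -
  have sum_pos: "0 < (\<Sum>u\<in>U. l u * g u)" if "\<And>u. u \<in> U \<Longrightarrow> 0 \<le> g u" "v \<in> U" "0 < g v" for g v
    using that l by (intro sum_pos2[OF U]) (auto intro: mult_pos_pos mult_nonneg_nonneg less_imp_le)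
  have ab: "0 < a u \<longleftrightarrow> 0 < b u" "a u < 0 \<longleftrightarrow> b u < 0" if "u \<in> U" for u
    using sgn[OF that] by (auto simp: sgn_real_def split: if_splits)
  consider (pos) v where "v \<in> U" "0 < a v" | (neg) v where "v \<in> U" "a v < 0"
    | (zero) "\<And>u. u \<in> U \<Longrightarrow> a u = 0"
    by (meson not_less_iff_gr_or_eq)
  then show ?thesis
  proof cases
    case pos
    have ge: "0 \<le> a u" "0 \<le> b u" if "u \<in> U" for u
      using no[OF pos(1) that] pos(2) ab[OF that] by auto
    have "0 < (\<Sum>u\<in>U. l u * a u)" "0 < (\<Sum>u\<in>U. l u * b u)"
      using sum_pos[of a v] sum_pos[of b v] ge pos ab by auto
    then show ?thesis by simp
  next
    case neg
    have ge: "0 \<le> - a u" "0 \<le> - b u" if "u \<in> U" for u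
      using no[OF that neg(1)] neg(2) ab[OF that] by auto
    have "0 < (\<Sum>u\<in>U. l u * - a u)" "0 < (\<Sum>u\<in>U. l u * - b u)"
      using sum_pos[of "\<lambda>u. - a u" v] sum_pos[of "\<lambda>u. - b u" v] ge neg ab by auto
    then show ?thesis by (simp add: sum_negf)
  next
    case zero
    then have "b u = 0" if "u \<in> U" for u using ab[OF that] zero[OF that] by (metis less_irrefl linorder_neqE_linordered_idom)
    with zero show ?thesis by simp
  qed
qed

text \<open>Decompose \<open>h\<close> into rays of the sample. If its sign at \<open>x\<close>
  differs from that at another point of the same class, two of these rays have opposite strict signs
  at \<open>x\<close>. Both are sign-compatible with \<open>h\<close> on the sample, so the sample
  misses their conflict set, which is therefore small; there are at most \<open>DIM('a)\<close>
  squared pairs to sum over.\<close>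

lemma cutting:
  fixes \<eta> :: real
  assumes "0 < \<eta>"
  shows "\<exists>r. \<forall>X :: 'a::euclidean_space set. finite X \<longrightarrow>
    (\<exists>f :: 'a \<Rightarrow> 'a set \<times> 'a set. card (f ` X) \<le> r \<and>
      (\<forall>h. real (card {x \<in> X. \<exists>y\<in>X. f y = f x \<and> sgn (h \<bullet> y) \<noteq> sgn (h \<bullet> x)}) \<le> \<eta> * real (card X)))"
proof -
  let ?d = "DIM('a)"
  \<comment> \<open>\<open>\<eta>\<close> is shared among all pairs of rays in one decomposition;
    the minimum with \<open>1/2\<close> keeps \<open>\<eta>'\<close> below 1, as
    \<open>sampling\<close> demands.\<close>
  define \<eta>' where "\<eta>' = min \<eta> (1/2) / (real ?d * real ?d)"
  have d: "1 \<le> real ?d" using DIM_positive[where 'a='a] by linarith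
  then have dd: "1 \<le> real ?d * real ?d" by (metis mult_mono' mult_1 zero_le_one)
  have "min \<eta> (1/2) / (real ?d * real ?d) \<le> min \<eta> (1/2) / 1"
    using dd assms by (intro divide_left_mono) auto
  then have \<eta>': "0 < \<eta>'" "\<eta>' < 1" using assms d by (auto simp: \<eta>'_def)
  have \<eta>'d: "real ?d * real ?d * \<eta>' \<le> \<eta>" using d by (simp add: \<eta>'_def)
  \<comment> \<open>A pair of rays depends on at most \<open>2 * ?d\<close> sample points, and
    \<open>Basis\<close> adds \<open>?d\<close> more; \<open>b\<close> bounds the rays of such a
    set.\<close>
  define b where "b = (2 * 2 ^ (3 * ?d) :: nat)"
  obtain m where m: "\<forall>(X :: 'a set) (\<D> :: 'a set \<Rightarrow> 'a set set).
     finite X \<longrightarrow> X \<noteq> {} \<longrightarrow>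
     (\<forall>T. T \<subseteq> X \<longrightarrow> card T \<le> 2 * ?d \<longrightarrow> finite (\<D> T) \<and> card (\<D> T) \<le> b * b) \<longrightarrow>
     (\<exists>R\<subseteq>X. card R \<le> m \<and>
       (\<forall>T\<subseteq>R. card T \<le> 2 * ?d \<longrightarrow> (\<forall>D\<in>\<D> T. D \<subseteq> X \<longrightarrow> R \<inter> D = {} \<longrightarrow> real (card D) \<le> \<eta>' * real (card X))))"
    using sampling[OF \<eta>', of "2 * ?d" "b * b"] by (elim exE)
  define n where "n = (2 * 2 ^ (m + ?d) :: nat)"
  show ?thesis
  proof (intro exI[of _ "2 ^ n * 2 ^ n"] allI impI)
    fix X :: "'a set" assume X: "finite X"
    show "\<exists>f :: 'a \<Rightarrow> 'a set \<times> 'a set. card (f ` X) \<le> 2 ^ n * 2 ^ n \<and>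
      (\<forall>h. real (card {x \<in> X. \<exists>y\<in>X. f y = f x \<and> sgn (h \<bullet> y) \<noteq> sgn (h \<bullet> x)}) \<le> \<eta> * real (card X))"
    proof (cases "X = {}")
      case False
      \<comment> \<open>Adding \<open>Basis\<close> makes the sample spanning, as \<open>ray_decomposition\<close> needs, even if \<open>X\<close> is degenerate.\<close>
      define conflict where "conflict = (\<lambda>(u, v). {x \<in> X. 0 < u \<bullet> x \<and> v \<bullet> x < 0})"
      define \<D> where "\<D> T = conflict ` (rays (T \<union> Basis) \<times> rays (T \<union> Basis))" for T
      have "\<forall>T. T \<subseteq> X \<longrightarrow> card T \<le> 2 * ?d \<longrightarrow> finite (\<D> T) \<and> card (\<D> T) \<le> b * b"
      proof (intro allI impI conjI)
        fix T assume that: "T \<subseteq> X" "card T \<le> 2 * ?d"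
        have fT: "finite (T \<union> Basis)" using that X finite_subset by auto
        note r = rays_finite_card[OF fT]
        show "finite (\<D> T)" using r(1) by (simp add: \<D>_def)
        have "card (T \<union> Basis) \<le> 3 * ?d" using card_Un_le[of T Basis] that by simp
        then have "(2::nat) ^ card (T \<union> Basis) \<le> 2 ^ (3 * ?d)" by (intro power_increasing) auto
        then have "card (rays (T \<union> Basis)) \<le> b" using r(2) unfolding b_def by linarith
        then have "card (rays (T \<union> Basis) \<times> rays (T \<union> Basis)) \<le> b * b"
          by (simp add: card_cartesian_product mult_le_mono)
        then show "card (\<D> T) \<le> b * b"
          unfolding \<D>_def using card_image_le[OF finite_SigmaI[OF r(1) r(1)]] le_trans by blast
      qed
      from m[THEN spec, THEN spec, THEN mp, THEN mp, THEN mp, OF X False this] obtain R where R: "R \<subseteq> X" "card R \<le> m"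
        and net: "\<forall>T\<subseteq>R. card T \<le> 2 * ?d \<longrightarrow> (\<forall>D\<in>\<D> T. D \<subseteq> X \<longrightarrow> R \<inter> D = {}
                   \<longrightarrow> real (card D) \<le> \<eta>' * real (card X))"
        by (elim exE conjE)
      have fR: "finite (R \<union> Basis)" using R X finite_subset by auto
      define V where "V = rays (R \<union> Basis)"
      note fV = rays_finite_card[OF fR, folded V_def]
      have "card (R \<union> Basis) \<le> m + ?d" using card_Un_le[of R Basis] R by simp
      then have "(2::nat) ^ card (R \<union> Basis) \<le> 2 ^ (m + ?d)" by (intro power_increasing) auto
      then have cV: "card V \<le> n" using fV(2) unfolding n_def by linarith
      \<comment> \<open>The two sets record which of the three signs each ray has at
        \<open>x\<close>.\<close>
      define f where "f x = ({u \<in> V. 0 < u \<bullet> x}, {u \<in> V. u \<bullet> x < 0})" for x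
      have "f ` X \<subseteq> Pow V \<times> Pow V" by (auto simp: f_def)
      then have "card (f ` X) \<le> card (Pow V \<times> Pow V)" using fV(1) by (intro card_mono) auto
      also have "\<dots> = 2 ^ card V * 2 ^ card V" using fV(1) by (simp add: card_cartesian_product card_Pow)
      also have "\<dots> \<le> 2 ^ n * 2 ^ n" using cV by (intro mult_le_mono power_increasing) auto
      finally have colours: "card (f ` X) \<le> 2 ^ n * 2 ^ n" .
      have "real (card {x \<in> X. \<exists>y\<in>X. f y = f x \<and> sgn (h \<bullet> y) \<noteq> sgn (h \<bullet> x)}) \<le> \<eta> * real (card X)"
        (is "real (card ?bad) \<le> _") for h
      proof -
        have sp: "span (R \<union> Basis) = (UNIV :: 'a set)"
          by (metis span_Basis span_mono sup_ge2 top.extremum_uniqueI)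
        obtain U l where U: "finite U" "U \<subseteq> V" "card U + dim (zeros (R \<union> Basis) h) \<le> ?d"
          "\<forall>u\<in>U. l u > (0::real) \<and> sign_compat (R \<union> Basis) h u" "h = (\<Sum>u\<in>U. l u *\<^sub>R u)"
          using ray_decomposition[OF fR sp, of h] unfolding V_def by blast
        have hx: "h \<bullet> x = (\<Sum>u\<in>U. l u * (u \<bullet> x))" for x
          by (subst U(5)) (simp add: inner_sum_left)
        have "?bad \<subseteq> (\<Union>z\<in>U \<times> U. conflict z)"
        proof
          fix x assume "x \<in> ?bad"
          then obtain y where xy: "x \<in> X" "y \<in> X" "f y = f x" "sgn (h \<bullet> y) \<noteq> sgn (h \<bullet> x)" by blast
          have "sgn (u \<bullet> x) = sgn (u \<bullet> y)" if "u \<in> U" for u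
          proof -
            have "u \<in> V" using that U(2) by blast
            then have "0 < u \<bullet> x \<longleftrightarrow> 0 < u \<bullet> y" "u \<bullet> x < 0 \<longleftrightarrow> u \<bullet> y < 0"
              using xy(3) unfolding f_def by blast+
            then show ?thesis by (auto simp: sgn_real_def)
          qed
          then have "\<exists>u\<in>U. \<exists>v\<in>U. 0 < u \<bullet> x \<and> v \<bullet> x < 0"
            using sgn_positive_combination[of U l "\<lambda>u. u \<bullet> x" "\<lambda>u. u \<bullet> y"] U(1,4) xy(4) unfolding hx by metis
          then show "x \<in> (\<Union>z\<in>U \<times> U. conflict z)" using xy(1) unfolding conflict_def by fast
        qed
        moreover have "finite (\<Union>z\<in>U \<times> U. conflict z)"
          by (rule finite_subset[OF _ X]) (auto simp: conflict_def)
        ultimately have "card ?bad \<le> card (\<Union>z\<in>U \<times> U. conflict z)" by (rule card_mono[rotated])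
        also have "\<dots> \<le> (\<Sum>z\<in>U \<times> U. card (conflict z))" using U(1) by (intro card_UN_le) simp
        finally have "real (card ?bad) \<le> (\<Sum>z\<in>U \<times> U. real (card (conflict z)))"
          by (subst of_nat_sum[symmetric], subst of_nat_le_iff)
        also have "\<dots> \<le> (\<Sum>z\<in>U \<times> U. \<eta>' * real (card X))"
        proof (rule sum_mono)
          fix z assume "z \<in> U \<times> U"
          then obtain u v where z: "z = (u, v)" "u \<in> U" "v \<in> U" by blast
          then have "u \<in> rays (R \<union> Basis)" "v \<in> rays (R \<union> Basis)" using U(2) by (auto simp: V_def)
          then obtain S T where S: "S \<subseteq> R" "finite S" "card S \<le> ?d" "u \<in> rays (S \<union> Basis)"
            and T: "T \<subseteq> R" "finite T" "card T \<le> ?d" "v \<in> rays (T \<union> Basis)"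
            using rays_localize by metis
          have "u \<in> rays ((S \<union> T) \<union> Basis)" "v \<in> rays ((S \<union> T) \<union> Basis)"
            using S(4) T(4) rays_mono[of "S \<union> Basis" "S \<union> T \<union> Basis"]
              rays_mono[of "T \<union> Basis" "S \<union> T \<union> Basis"] by blast+
          then have "conflict z \<in> \<D> (S \<union> T)" unfolding \<D>_def z by blast
          moreover have ST: "card (S \<union> T) \<le> 2 * ?d" using card_Un_le[of S T] S T by linarith
          moreover have "R \<inter> conflict z = {}"
          proof -
            have "\<not> (0 < u \<bullet> x \<and> v \<bullet> x < 0)" if "x \<in> R" for x
              using U(4) z that unfolding sign_compat_def by (meson UnI1 linorder_le_cases not_le)
            then show ?thesis by (auto simp: conflict_def z)
          qed
          moreover have "conflict z \<subseteq> X" by (auto simp: conflict_def z)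
          ultimately show "real (card (conflict z)) \<le> \<eta>' * real (card X)"
            using net[rule_format, of "S \<union> T" "conflict z"] S(1) T(1) by blast
        qed
        also have "\<dots> = real (card U) * real (card U) * \<eta>' * real (card X)"
          by (simp add: card_cartesian_product)
        also have "\<dots> \<le> real ?d * real ?d * \<eta>' * real (card X)"
          using U(3) \<eta>' by (intro mult_right_mono mult_mono) auto
        also have "\<dots> \<le> \<eta> * real (card X)" using \<eta>'d by (intro mult_right_mono) auto
        finally show ?thesis .
      qed
      then show ?thesis using colours by blast
    qed auto
  qed
qed

section \<open>Centerpoints\<close>

text \<open>With \<open>d = DIM('a)\<close>, apply Helly to the hulls of all subsets holding more
  than a fraction \<open>d / (d + 1)\<close> of \<open>Q\<close>. The complements of
  \<open>d + 1\<close> such subsets are too small to cover \<open>Q\<close>, so the subsets share a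
  point. A convex set missing the common point \<open>a\<close> of all hulls contains no such
  subset.\<close>

lemma centerpoint:
  fixes Q :: "'a::euclidean_space set"
  assumes Q: "finite Q"
  obtains a where "\<And>C. convex C \<Longrightarrow> a \<notin> C \<Longrightarrow> (DIM('a) + 1) * card (Q \<inter> C) \<le> DIM('a) * card Q"
proof -
  let ?d = "DIM('a)"
  define \<S> where "\<S> = {S. S \<subseteq> Q \<and> ?d * card Q < (?d + 1) * card S}"
  have fS: "finite \<S>" using Q by (auto simp: \<S>_def)
  have small: "\<Inter>t \<noteq> {}" if t: "t \<subseteq> (hull) convex ` \<S>" "card t \<le> ?d + 1" for t
  proof (cases "t = {}")
    case False
    \<comment> \<open>One subset is taken per hull, so that \<open>card t\<close> also bounds the
      number of subsets.\<close>
    obtain \<T> where T: "\<T> \<subseteq> \<S>" "inj_on ((hull) convex) \<T>" "t = (hull) convex ` \<T>"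
      using t(1) subset_image_inj[of t "(hull) convex" \<S>] by blast
    have fT: "finite \<T>" using T(1) fS finite_subset by blast
    have ne: "\<T> \<noteq> {}" using T(3) False by blast
    have cT: "card \<T> \<le> ?d + 1" using t(2) T by (simp add: card_image)
    have each: "(?d + 1) * card (Q - S) < card Q" if "S \<in> \<T>" for S
    proof -
      have S: "S \<subseteq> Q" "?d * card Q < (?d + 1) * card S" using that T(1) by (auto simp: \<S>_def)
      then have "card Q = card S + card (Q - S)"
        using Q card_Diff_subset[of S Q] card_mono[OF Q S(1)] finite_subset by force
      then have "(?d + 1) * card Q = (?d + 1) * card S + (?d + 1) * card (Q - S)"
        by (simp add: algebra_simps)
      then show ?thesis using S(2) by (simp add: algebra_simps)
    qed
    have "(?d + 1) * card (\<Union>S\<in>\<T>. Q - S) \<le> (?d + 1) * (\<Sum>S\<in>\<T>. card (Q - S))"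
      using card_UN_le[OF fT] by (intro mult_le_mono2) blast
    also have "\<dots> = (\<Sum>S\<in>\<T>. (?d + 1) * card (Q - S))" by (rule sum_distrib_left)
    also have "\<dots> < (\<Sum>S\<in>\<T>. card Q)" using each by (intro sum_strict_mono[OF fT ne])
    also have "\<dots> \<le> (?d + 1) * card Q" using cT by (simp only: sum_constant) (rule mult_le_mono1, simp)
    finally have "card (\<Union>S\<in>\<T>. Q - S) < card Q" by (simp only: nat_mult_less_cancel_disj)
    then have "\<not> Q \<subseteq> (\<Union>S\<in>\<T>. Q - S)"
      using card_mono[of "\<Union>S\<in>\<T>. Q - S" Q] Q fT by fastforce
    then obtain q where "\<forall>S\<in>\<T>. q \<in> S" by blast
    then have "\<forall>S\<in>\<T>. q \<in> convex hull S" by (simp add: hull_inc)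
    then show ?thesis using T(3) by blast
  qed auto
  have "\<Inter>((hull) convex ` \<S>) \<noteq> {}"
  \<comment> \<open>\<open>Helly\<close> needs at least \<open>?d + 1\<close> sets; a smaller family
    is handled by \<open>small\<close> directly.\<close>
  proof (cases "card ((hull) convex ` \<S>) \<le> ?d + 1")
    case True
    then show ?thesis using small by blast
  next
    case False
    show ?thesis
      by (rule Helly) (use False small in \<open>auto simp: convex_convex_hull\<close>)
  qed
  then obtain a where a: "\<And>S. S \<in> \<S> \<Longrightarrow> a \<in> convex hull S" by blast
  show ?thesis
  proof (rule that[of a], rule ccontr)
    fix C assume C: "convex C" "a \<notin> C" "\<not> (?d + 1) * card (Q \<inter> C) \<le> ?d * card Q"
    then have "Q \<inter> C \<in> \<S>" by (simp add: \<S>_def)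
    then have "a \<in> convex hull (Q \<inter> C)" by (rule a)
    also have "\<dots> \<subseteq> C" using C(1) by (simp add: hull_minimal)
    finally show False using C(2) by blast
  qed
qed

text \<open>An open half-space \<open>H\<close> with \<open>C \<inter> Q\<close> inside and the
  centerpoint \<open>a\<close> outside holds at most a fraction \<open>d / (d + 1)\<close> of
  \<open>Q\<close>. A point of \<open>Q\<close> outside \<open>H\<close> whose class is not split by
  the boundary of \<open>H\<close> lies in a class free of \<open>C\<close>.\<close>

lemma stabbing_point:
  obtains \<delta> :: real and r where "0 < \<delta>"
    "\<forall>Q :: 'a::euclidean_space set. finite Q \<longrightarrow>
       (\<exists>a (f :: 'a \<Rightarrow> ('a \<times> real) set \<times> ('a \<times> real) set). card (f ` Q) \<le> r \<and>
         (\<forall>C. convex C \<longrightarrow> a \<notin> C \<longrightarrow>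
           \<delta> * real (card Q) \<le> real (card {x \<in> Q. \<forall>y\<in>Q. f y = f x \<longrightarrow> y \<notin> C})))"
proof -
  define d where "d = real (DIM('a))"
  \<comment> \<open>Half of the fraction \<open>1 / (d + 1)\<close> outside \<open>H\<close> is
    given up to split classes; the other half remains.\<close>
  define \<delta> where "\<delta> = 1 / (2 * (d + 1))"
  have d: "0 \<le> d" by (simp add: d_def)
  have \<delta>: "0 < \<delta>" using d by (simp add: \<delta>_def)
  obtain r where r: "\<forall>X :: ('a \<times> real) set. finite X \<longrightarrow>
    (\<exists>f :: 'a \<times> real \<Rightarrow> ('a \<times> real) set \<times> ('a \<times> real) set. card (f ` X) \<le> r \<and>
      (\<forall>h. real (card {x \<in> X. \<exists>y\<in>X. f y = f x \<and> sgn (h \<bullet> y) \<noteq> sgn (h \<bullet> x)}) \<le> \<delta> * real (card X)))"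
    using cutting[OF \<delta>] by (elim exE)
  have "\<exists>a (f :: 'a \<Rightarrow> ('a \<times> real) set \<times> ('a \<times> real) set). card (f ` Q) \<le> r \<and>
         (\<forall>C. convex C \<longrightarrow> a \<notin> C \<longrightarrow>
           \<delta> * real (card Q) \<le> real (card {x \<in> Q. \<forall>y\<in>Q. f y = f x \<longrightarrow> y \<notin> C}))"
    if Q: "finite Q" for Q :: "'a set"
  proof -
    \<comment> \<open>Lifting to height 1 turns affine functionals into linear ones, so
      \<open>cutting\<close> is used in one dimension more.\<close>
    define lift where "lift x = (x, 1 :: real)" for x :: 'a
    have inj: "inj_on lift S" for S by (auto simp: inj_on_def lift_def)
    have "finite (lift ` Q)" using Q by simp
    from r[THEN spec, THEN mp, OF this]
    obtain g :: "'a \<times> real \<Rightarrow> ('a \<times> real) set \<times> ('a \<times> real) set" where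
      g: "card (g ` lift ` Q) \<le> r"
      "\<forall>h. real (card {x \<in> lift ` Q. \<exists>y\<in>lift ` Q. g y = g x \<and> sgn (h \<bullet> y) \<noteq> sgn (h \<bullet> x)})
         \<le> \<delta> * real (card (lift ` Q))"
      by (elim exE conjE)
    obtain a where a: "\<And>C. convex C \<Longrightarrow> a \<notin> C \<Longrightarrow> (DIM('a) + 1) * card (Q \<inter> C) \<le> DIM('a) * card Q"
      using centerpoint[OF Q] by blast
    define f where "f = g \<circ> lift"
    have "\<delta> * real (card Q) \<le> real (card {x \<in> Q. \<forall>y\<in>Q. f y = f x \<longrightarrow> y \<notin> C})"
      (is "_ \<le> real (card ?M)") if C: "convex C" "a \<notin> C" for C
    proof -
      \<comment> \<open>\<open>C\<close> need not be closed, so \<open>a\<close> is separated from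
        the hull of the finite set \<open>Q \<inter> C\<close> instead.\<close>
      have "a \<notin> convex hull (Q \<inter> C)"
        using C hull_minimal[of "Q \<inter> C" C convex] by blast
      moreover have "closed (convex hull (Q \<inter> C))"
        using Q by (simp add: compact_imp_closed finite_imp_compact_convex_hull)
      ultimately obtain b \<beta> where b: "b \<bullet> a < \<beta>" "\<forall>x\<in>convex hull (Q \<inter> C). \<beta> < b \<bullet> x"
        using separating_hyperplane_closed_point[of "convex hull (Q \<inter> C)" a] by (auto simp: convex_convex_hull)
      have bC: "\<beta> < b \<bullet> x" if "x \<in> Q" "x \<in> C" for x
        using b(2) that hull_inc[of x "Q \<inter> C" convex] by blast
      define H where "H = {x. \<beta> < b \<bullet> x}"
      define h where "h = (b, - \<beta>)"
      have h: "h \<bullet> lift x = b \<bullet> x - \<beta>" for x by (simp add: h_def lift_def)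
      define B where "B = {x \<in> Q. \<exists>y\<in>Q. f y = f x \<and> sgn (h \<bullet> lift y) \<noteq> sgn (h \<bullet> lift x)}"
      have "{x \<in> lift ` Q. \<exists>y\<in>lift ` Q. g y = g x \<and> sgn (h \<bullet> y) \<noteq> sgn (h \<bullet> x)} = lift ` B"
        unfolding B_def f_def Compr_image_eq by simp
      then have cB: "real (card B) \<le> \<delta> * real (card Q)"
        using g(2)[THEN spec, of h] by (simp add: card_image[OF inj])
      have "convex H" unfolding H_def by (rule convex_halfspace_gt)
      then have "(DIM('a) + 1) * card (Q \<inter> H) \<le> DIM('a) * card Q"
        using b(1) by (intro a) (auto simp: H_def)
      then have "real ((DIM('a) + 1) * card (Q \<inter> H)) \<le> real (DIM('a) * card Q)"
        by (simp only: of_nat_le_iff)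
      then have cH: "(d + 1) * real (card (Q \<inter> H)) \<le> d * real (card Q)" by (simp add: d_def algebra_simps)
      have "Q \<subseteq> ?M \<union> (Q \<inter> H) \<union> B"
      proof
        fix x assume x: "x \<in> Q"
        show "x \<in> ?M \<union> (Q \<inter> H) \<union> B"
        proof (cases "x \<in> H \<or> x \<in> B")
          case False
          have "y \<notin> C" if "y \<in> Q" "f y = f x" for y
          proof
            assume "y \<in> C"
            then have "h \<bullet> lift y > 0" using bC that h by simp
            moreover have "sgn (h \<bullet> lift y) = sgn (h \<bullet> lift x)" using False x that unfolding B_def by blast
            ultimately have "h \<bullet> lift x > 0" by (simp add: sgn_real_def split: if_splits)
            then show False using False by (simp add: h H_def)
          qed
          then show ?thesis using x by blast
        qed (use x in blast)
      qed
      then have "card Q \<le> card (?M \<union> (Q \<inter> H) \<union> B)" using Q by (intro card_mono) (auto simp: B_def)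
      also have "\<dots> \<le> card ?M + card (Q \<inter> H) + card B"
        using card_Un_le[of "?M \<union> (Q \<inter> H)" B] card_Un_le[of ?M "Q \<inter> H"] by linarith
      finally have "real (card Q) \<le> real (card ?M) + real (card (Q \<inter> H)) + real (card B)" by linarith
      moreover have "real (card (Q \<inter> H)) \<le> real (card Q) - 2 * \<delta> * real (card Q)"
        using cH d by (simp add: \<delta>_def field_simps)
      ultimately show ?thesis using cB by linarith
    qed
    moreover have "card (f ` Q) \<le> r" using g(1) by (simp add: f_def image_comp)
    ultimately show ?thesis by blast
  qed
  then show ?thesis using \<delta> by (intro that[of \<delta> r] allI impI)
qed

section \<open>Multiscale approximants\<close>

lemma filter_mset_sum:
  "{#x \<in># (\<Sum>i\<in>I. A i). P x#} = (\<Sum>i\<in>I. {#x \<in># A i. P x#})"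
  by (induction I rule: infinite_finite_induct) auto

lemma size_filter_replicate_mset:
  "size {#x \<in># replicate_mset n a. P x#} = (if P a then n else 0)"
  by (induction n) auto

lemma card_fibres:
  assumes "finite Q" "S \<subseteq> Q"
  shows "card S = (\<Sum>c\<in>f ` Q. card {x \<in> S. f x = c})"
proof -
  have "(\<Sum>c\<in>f ` Q. \<Sum>x\<in>{x \<in> S. f x = c}. 1::nat) = (\<Sum>x\<in>S. 1)"
    using assms by (intro sum.group) (auto intro: finite_subset)
  then show ?thesis by simp
qed

text \<open>Refinement raises \<open>x\<^sup>2 / q\<close> by the variance of the class densities,
  each class weighted by its size. The classes avoiding \<open>C\<close> have total size
  \<open>m\<close> and density 0, so each deviates from the mean by \<open>x / q\<close>.\<close>

lemma variance_gain:
  fixes f :: "'a \<Rightarrow> 'b" and C :: "'a set"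
  assumes Q: "finite Q"
  defines "q \<equiv> real (card Q)" and "x \<equiv> real (card (C \<inter> Q))"
    and "m \<equiv> real (card {x \<in> Q. \<forall>y\<in>Q. f y = f x \<longrightarrow> y \<notin> C})"
  shows "x\<^sup>2 / q + (x / q)\<^sup>2 * m
    \<le> (\<Sum>c\<in>f ` Q. (real (card (C \<inter> {x \<in> Q. f x = c})))\<^sup>2 / real (card {x \<in> Q. f x = c}))"
proof -
  define qc where "qc c = real (card {x \<in> Q. f x = c})" for c
  define xc where "xc c = real (card (C \<inter> {x \<in> Q. f x = c}))" for c
  define mc where "mc c = (if xc c = 0 then qc c else 0)" for c
  define t where "t = x / q"
  have q: "q = (\<Sum>c\<in>f ` Q. qc c)" unfolding q_def qc_def
    by (subst card_fibres[OF Q order_refl, of f]) simp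
  have "{y \<in> C \<inter> Q. f y = c} = C \<inter> {y \<in> Q. f y = c}" for c by auto
  then have x: "x = (\<Sum>c\<in>f ` Q. xc c)" unfolding x_def xc_def
    by (subst card_fibres[OF Q, of _ f]) auto
  have fibre: "real (card {y \<in> {x \<in> Q. \<forall>y\<in>Q. f y = f x \<longrightarrow> y \<notin> C}. f y = c}) = mc c" for c
  proof (cases "C \<inter> {x \<in> Q. f x = c} = {}")
    case True
    then have "{y \<in> {x \<in> Q. \<forall>y\<in>Q. f y = f x \<longrightarrow> y \<notin> C}. f y = c} = {x \<in> Q. f x = c}" by auto
    then show ?thesis using True by (simp add: mc_def xc_def qc_def)
  next
    case False
    then have *: "{y \<in> {x \<in> Q. \<forall>y\<in>Q. f y = f x \<longrightarrow> y \<notin> C}. f y = c} = {}" by auto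
    have "xc c \<noteq> 0" using False Q by (simp add: xc_def)
    then show ?thesis unfolding * by (simp add: mc_def)
  qed
  have "m = (\<Sum>c\<in>f ` Q. real (card {y \<in> {x \<in> Q. \<forall>y\<in>Q. f y = f x \<longrightarrow> y \<notin> C}. f y = c}))"
    unfolding m_def by (subst card_fibres[OF Q, of _ f]) auto
  then have m: "m = (\<Sum>c\<in>f ` Q. mc c)" by (simp only: fibre)
  \<comment> \<open>\<open>(xc - t qc)\<^sup>2 \<ge> 0\<close>, summed over the classes that meet \<open>C\<close> only.\<close>
  have le: "2 * t * xc c - t\<^sup>2 * (qc c - mc c) \<le> (xc c)\<^sup>2 / qc c" if "c \<in> f ` Q" for c
  proof -
    have "{x \<in> Q. f x = c} \<noteq> {}" using that by auto
    then have qpos: "0 < qc c" using Q by (simp add: qc_def card_gt_0_iff)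
    show ?thesis
    proof (cases "xc c = 0")
      case False
      have "0 \<le> (xc c - t * qc c)\<^sup>2 / qc c" using qpos by simp
      also have "\<dots> = (xc c)\<^sup>2 / qc c - (2 * t * xc c - t\<^sup>2 * qc c)"
        using qpos by (simp add: power2_eq_square field_simps)
      finally show ?thesis using False by (simp add: mc_def)
    qed (simp add: mc_def)
  qed
  have "x\<^sup>2 / q + (x / q)\<^sup>2 * m = 2 * t * x - t\<^sup>2 * (q - m)"
    by (cases "q = 0") (simp_all add: t_def power2_eq_square field_simps)
  also have "\<dots> = (\<Sum>c\<in>f ` Q. 2 * t * xc c - t\<^sup>2 * (qc c - mc c))"
    unfolding x q m by (simp add: sum_subtractf flip: sum_distrib_left)
  also have "\<dots> \<le> (\<Sum>c\<in>f ` Q. (xc c)\<^sup>2 / qc c)" by (intro sum_mono le)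
  finally show ?thesis unfolding xc_def qc_def .
qed

text \<open>
  The subtracted potential \<open>q - x\<^sup>2 / q\<close> is additive over the classes of a partition and decreases
  under refinement; every level at which the stabbing point of a set with \<open>x > \<epsilon> q\<close> is not in \<open>C\<close> is
  paid for by the decrease in \<open>variance_gain\<close>.
\<close>

lemma multiscale_approximant:
  fixes \<delta> \<epsilon> :: real
  assumes \<delta>: "0 < \<delta>" and \<epsilon>: "0 < \<epsilon>"
    and stab: "\<forall>Q :: 'a::euclidean_space set. finite Q \<longrightarrow>
       (\<exists>a (f :: 'a \<Rightarrow> 'b). card (f ` Q) \<le> r \<and>
         (\<forall>C. convex C \<longrightarrow> a \<notin> C \<longrightarrow>
           \<delta> * real (card Q) \<le> real (card {x \<in> Q. \<forall>y\<in>Q. f y = f x \<longrightarrow> y \<notin> C})))"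
  shows "\<exists>N. \<forall>Q :: 'a set. finite Q \<longrightarrow>
    (\<exists>A. size A = s * card Q \<and> card (set_mset A) \<le> N \<and>
      (\<forall>C. convex C \<longrightarrow>
        real s * (real (card (C \<inter> Q)) - \<epsilon> * real (card Q))
          - (real (card Q) - (real (card (C \<inter> Q)))\<^sup>2 / real (card Q)) / (\<delta> * \<epsilon>)
        \<le> real (size {#x \<in># A. x \<in> C#})))"
proof (induction s)
  case 0
  \<comment> \<open>The potential is nonnegative, so the empty multiset serves at level 0.\<close>
  have "(real (card (C \<inter> Q)))\<^sup>2 / real (card Q) \<le> real (card Q)" if Q: "finite Q" for Q C :: "'a set"
  proof -
    have "real (card (C \<inter> Q)) \<le> real (card Q)" using Q by (simp add: card_mono)
    then have "(real (card (C \<inter> Q)))\<^sup>2 \<le> (real (card Q))\<^sup>2" by (intro power_mono) auto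
    then show ?thesis by (cases "card Q = 0") (simp_all add: power2_eq_square divide_simps)
  qed
  then show ?case using \<delta> \<epsilon>
    by (intro exI[of _ 0] allI impI exI[of _ "{#}"]) simp
next
  case (Suc s)
  then obtain N where IH: "\<forall>Q :: 'a set. finite Q \<longrightarrow>
    (\<exists>A. size A = s * card Q \<and> card (set_mset A) \<le> N \<and>
      (\<forall>C. convex C \<longrightarrow>
        real s * (real (card (C \<inter> Q)) - \<epsilon> * real (card Q))
          - (real (card Q) - (real (card (C \<inter> Q)))\<^sup>2 / real (card Q)) / (\<delta> * \<epsilon>)
        \<le> real (size {#x \<in># A. x \<in> C#})))" by (elim exE)
  show ?case
  proof (intro exI[of _ "1 + r * N"] allI impI)
    fix Q :: "'a set" assume Q: "finite Q"
    from stab[THEN spec, THEN mp, OF Q] obtain a and f :: "'a \<Rightarrow> 'b" where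
      f: "card (f ` Q) \<le> r" and
      a: "\<forall>C. convex C \<longrightarrow> a \<notin> C \<longrightarrow>
           \<delta> * real (card Q) \<le> real (card {x \<in> Q. \<forall>y\<in>Q. f y = f x \<longrightarrow> y \<notin> C})"
      by (elim exE conjE)
    define F where "F c = {x \<in> Q. f x = c}" for c
    have "\<forall>c. finite (F c)" using Q by (simp add: F_def)
    then have "\<forall>c. \<exists>A. size A = s * card (F c) \<and> card (set_mset A) \<le> N \<and>
      (\<forall>C. convex C \<longrightarrow>
        real s * (real (card (C \<inter> F c)) - \<epsilon> * real (card (F c)))
          - (real (card (F c)) - (real (card (C \<inter> F c)))\<^sup>2 / real (card (F c))) / (\<delta> * \<epsilon>)
        \<le> real (size {#x \<in># A. x \<in> C#}))" using IH by blast
    from choice[OF this] obtain A where A: "\<forall>c. size (A c) = s * card (F c) \<and> card (set_mset (A c)) \<le> N \<and>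
      (\<forall>C. convex C \<longrightarrow>
        real s * (real (card (C \<inter> F c)) - \<epsilon> * real (card (F c)))
          - (real (card (F c)) - (real (card (C \<inter> F c)))\<^sup>2 / real (card (F c))) / (\<delta> * \<epsilon>)
        \<le> real (size {#x \<in># A c. x \<in> C#}))" by (elim exE)
    \<comment> \<open>The stabbing point gets weight \<open>card Q\<close> and the classes together
      carry \<open>s * card Q\<close>, so all levels weigh the same. The number of distinct points
      stays bounded independently of \<open>Q\<close>.\<close>
    define A' where "A' = replicate_mset (card Q) a + (\<Sum>c\<in>f ` Q. A c)"
    have cQ: "card Q = (\<Sum>c\<in>f ` Q. card (F c))"
      unfolding F_def by (rule card_fibres[OF Q order_refl])
    have cC: "card (C \<inter> Q) = (\<Sum>c\<in>f ` Q. card (C \<inter> F c))" for C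
    proof -
      have "{x \<in> C \<inter> Q. f x = c} = C \<inter> F c" for c by (auto simp: F_def)
      then show ?thesis using card_fibres[OF Q, of "C \<inter> Q" f] by simp
    qed
    show "\<exists>A. size A = Suc s * card Q \<and> card (set_mset A) \<le> 1 + r * N \<and>
      (\<forall>C. convex C \<longrightarrow>
        real (Suc s) * (real (card (C \<inter> Q)) - \<epsilon> * real (card Q))
          - (real (card Q) - (real (card (C \<inter> Q)))\<^sup>2 / real (card Q)) / (\<delta> * \<epsilon>)
        \<le> real (size {#x \<in># A. x \<in> C#}))"
    proof (intro exI[of _ A'] conjI allI impI)
      have "(\<Sum>c\<in>f ` Q. size (A c)) = (\<Sum>c\<in>f ` Q. s * card (F c))" using A by simp
      also have "\<dots> = s * card Q" by (simp only: cQ sum_distrib_left)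
      finally show "size A' = Suc s * card Q" by (simp add: A'_def)
    next
      have "card (set_mset A') \<le> card (set_mset (replicate_mset (card Q) a))
              + card (set_mset (\<Sum>c\<in>f ` Q. A c))"
        unfolding A'_def set_mset_union by (rule card_Un_le)
      also have "card (set_mset (replicate_mset (card Q) a)) \<le> 1" by simp
      also have "card (set_mset (\<Sum>c\<in>f ` Q. A c)) \<le> (\<Sum>c\<in>f ` Q. card (set_mset (A c)))"
        using Q card_UN_le[of "f ` Q" "\<lambda>c. set_mset (A c)"] by (simp only: set_mset_sum finite_imageI)
      also have "\<dots> \<le> (\<Sum>c\<in>f ` Q. N)" using A by (intro sum_mono) simp
      also have "\<dots> \<le> r * N" using f by simp
      finally show "card (set_mset A') \<le> 1 + r * N" by simp
    next
      fix C :: "'a set" assume C: "convex C"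
      define q where "q = real (card Q)"
      define x where "x = real (card (C \<inter> Q))"
      define m where "m = real (card {x \<in> Q. \<forall>y\<in>Q. f y = f x \<longrightarrow> y \<notin> C})"
      define V where "V = (\<Sum>c\<in>f ` Q. (real (card (C \<inter> F c)))\<^sup>2 / real (card (F c)))"
      define I where "I = (if a \<in> C then q else 0)"
      have xq: "0 \<le> x" "x \<le> q" "0 \<le> q" using Q by (simp_all add: x_def q_def card_mono)
      have gain: "x\<^sup>2 / q + (x / q)\<^sup>2 * m \<le> V"
        unfolding x_def q_def m_def V_def F_def by (rule variance_gain[OF Q])
      \<comment> \<open>Account of the top level: if \<open>a \<in> C\<close>, the weight
        \<open>q\<close> covers \<open>x\<close>; if the density is at most
        \<open>\<epsilon>\<close>, nothing is owed. Otherwise \<open>\<delta> * q \<le> m\<close>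
        makes the gain at least \<open>\<delta> * \<epsilon> * x\<close>, whence the
        divisor.\<close>
      have "x - \<epsilon> * q \<le> I + (V - x\<^sup>2 / q) / (\<delta> * \<epsilon>)"
      proof (cases "a \<in> C \<or> x \<le> \<epsilon> * q")
        case True
        have "0 \<le> (x / q)\<^sup>2 * m" by (simp add: m_def)
        then have "0 \<le> (V - x\<^sup>2 / q) / (\<delta> * \<epsilon>)" using gain \<delta> \<epsilon> by simp
        moreover have "x - \<epsilon> * q \<le> I"
          using True xq \<epsilon> by (auto simp: I_def intro: order_trans[of _ x])
        ultimately show ?thesis by linarith
      next
        case False
        then have qpos: "0 < q" and big: "\<epsilon> * q \<le> x" using xq by (cases "q = 0", auto)
        have "\<delta> * q \<le> m" using a[THEN spec, of C] C False by (simp add: q_def m_def)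
        then have "(x / q)\<^sup>2 * (\<delta> * q) \<le> (x / q)\<^sup>2 * m" by (intro mult_left_mono) auto
        then have "(x / q)\<^sup>2 * (\<delta> * q) \<le> V - x\<^sup>2 / q" using gain by linarith
        then have "(x / q)\<^sup>2 * (\<delta> * q) / (\<delta> * \<epsilon>) \<le> (V - x\<^sup>2 / q) / (\<delta> * \<epsilon>)"
          using \<delta> \<epsilon> by (intro divide_right_mono) auto
        moreover have "x \<le> (x / q)\<^sup>2 * (\<delta> * q) / (\<delta> * \<epsilon>)"
        proof -
          have "(x / q)\<^sup>2 * (\<delta> * q) / (\<delta> * \<epsilon>) = x * x / (\<epsilon> * q)"
            using \<delta> qpos by (simp add: power2_eq_square)
          moreover have "x * (\<epsilon> * q) \<le> x * x" using big xq by (intro mult_left_mono) auto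
          ultimately show ?thesis using \<epsilon> qpos by (simp add: pos_le_divide_eq)
        qed
        moreover have "0 \<le> \<epsilon> * q" using \<epsilon> qpos by simp
        moreover have "0 \<le> I" using xq by (simp add: I_def)
        ultimately show ?thesis by linarith
      qed
      then have "real (Suc s) * (x - \<epsilon> * q) - (q - x\<^sup>2 / q) / (\<delta> * \<epsilon>)
          \<le> I + (real s * (x - \<epsilon> * q) - (q - V) / (\<delta> * \<epsilon>))"
        by (simp add: algebra_simps diff_divide_distrib)
      \<comment> \<open>\<open>x\<close>, \<open>q\<close> and \<open>V\<close> are sums over the
        classes, so the account of the remaining \<open>s\<close> levels splits into the induction
        hypotheses.\<close>
      also have "real s * (x - \<epsilon> * q) - (q - V) / (\<delta> * \<epsilon>) =
          (\<Sum>c\<in>f ` Q. real s * (real (card (C \<inter> F c)) - \<epsilon> * real (card (F c)))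
            - (real (card (F c)) - (real (card (C \<inter> F c)))\<^sup>2 / real (card (F c))) / (\<delta> * \<epsilon>))"
        unfolding x_def q_def V_def cQ cC of_nat_sum
        by (simp add: sum_subtractf flip: sum_distrib_left sum_divide_distrib)
      also have "\<dots> \<le> (\<Sum>c\<in>f ` Q. real (size {#x \<in># A c. x \<in> C#}))"
        using A C by (intro sum_mono) blast
      also have "I + \<dots> = real (size {#x \<in># A'. x \<in> C#})"
        by (simp add: A'_def filter_mset_sum size_filter_replicate_mset I_def q_def)
      finally show "real (Suc s) * (real (card (C \<inter> Q)) - \<epsilon> * real (card Q))
          - (real (card Q) - (real (card (C \<inter> Q)))\<^sup>2 / real (card Q)) / (\<delta> * \<epsilon>)
        \<le> real (size {#x \<in># A'. x \<in> C#})" unfolding x_def q_def by simp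
    qed
  qed
qed

section \<open>Rounding multiplicities to a bounded total\<close>

lemma size_filter_mset_eq_sum:
  assumes "finite S" "set_mset A \<subseteq> S"
  shows "size {#x \<in># A. P x#} = (\<Sum>x\<in>S. if P x then count A x else 0)"
proof -
  have "size {#x \<in># A. P x#} = (\<Sum>x\<in>set_mset {#x \<in># A. P x#}. count {#x \<in># A. P x#} x)"
    by (simp add: size_multiset_overloaded_eq)
  also have "\<dots> = (\<Sum>x\<in>S. count {#x \<in># A. P x#} x)"
    using assms by (intro sum.mono_neutral_left) (auto simp: count_eq_zero_iff)
  finally show ?thesis by simp
qed

text \<open>Rescale the multiplicities to total \<open>T\<close> and round down. Each distinct point
  loses less than 1, so every set loses at most \<open>N\<close>, a fraction \<open>N / T\<close> of
  the total.\<close>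

lemma bounded_size_rounding:
  fixes \<epsilon> :: real
  assumes "0 < \<epsilon>"
  shows "\<exists>g. \<forall>A :: 'a multiset. A \<noteq> {#} \<longrightarrow> card (set_mset A) \<le> N \<longrightarrow>
    (\<exists>B. B \<noteq> {#} \<and> size B \<le> g \<and>
      (\<forall>C. real (size {#x \<in># A. x \<in> C#}) / real (size A) - \<epsilon>
          \<le> real (size {#x \<in># B. x \<in> C#}) / real (size B)))"
proof -
  \<comment> \<open>\<open>T \<ge> N / \<epsilon>\<close> makes the relative loss at most
    \<open>\<epsilon>\<close>, and \<open>T > N\<close> keeps \<open>B\<close> nonempty.\<close>
  define T where "T = nat \<lceil>real N / \<epsilon>\<rceil> + N + 1"
  have T: "N < T" "real N / \<epsilon> \<le> real T" unfolding T_def by linarith+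
  then have NT: "real N / real T \<le> \<epsilon>"
    using assms by (simp add: divide_le_eq mult.commute)
  show ?thesis
  proof (intro exI[of _ T] allI impI)
    fix A :: "'a multiset" assume A: "A \<noteq> {#}" "card (set_mset A) \<le> N"
    define n where "n = size A"
    have n: "0 < n" using A by (simp add: n_def nonempty_has_size)
    define k where "k x = T * count A x div n" for x
    define B where "B = (\<Sum>x\<in>set_mset A. replicate_mset (k x) x)"
    have cB: "count B x = k x" for x
    proof -
      have "count B x = (\<Sum>y\<in>set_mset A. if x = y then k y else 0)"
        unfolding B_def count_sum by (intro sum.cong) auto
      also have "\<dots> = (if x \<in># A then k x else 0)" by simp
      also have "\<dots> = k x" by (cases "x \<in># A") (simp_all add: k_def not_in_iff)
      finally show ?thesis .
    qed
    have setB: "set_mset B \<subseteq> set_mset A"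
    proof
      fix x assume "x \<in># B"
      then have "k x \<noteq> 0" using cB by (metis count_eq_zero_iff)
      then show "x \<in># A" unfolding k_def by (metis count_eq_zero_iff div_0 mult_0_right)
    qed
    have sizeB: "size {#x \<in># B. x \<in> C#} = (\<Sum>x\<in>set_mset A. if x \<in> C then k x else 0)" for C
      using size_filter_mset_eq_sum[OF _ setB, of "\<lambda>x. x \<in> C"] by (simp add: cB cong: if_cong)
    have sizeA: "size {#x \<in># A. x \<in> C#} = (\<Sum>x\<in>set_mset A. if x \<in> C then count A x else 0)" for C
      using size_filter_mset_eq_sum[of "set_mset A" A "\<lambda>x. x \<in> C"] by simp
    have "size B = (\<Sum>x\<in>set_mset A. k x)" using sizeB[of UNIV] by simp
    then have "size B * n = (\<Sum>x\<in>set_mset A. k x * n)" by (simp add: sum_distrib_right)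
    also have "\<dots> \<le> (\<Sum>x\<in>set_mset A. T * count A x)" by (intro sum_mono) (simp add: k_def)
    also have "\<dots> = T * n" using sizeA[of UNIV] by (simp add: sum_distrib_left n_def)
    finally have BT: "size B \<le> T" using n by simp
    have lower: "real T * (real (size {#x \<in># A. x \<in> C#}) / real n) - real N \<le> real (size {#x \<in># B. x \<in> C#})" for C
    proof -
      have "real T * real (count A x) / real n - 1 \<le> real (k x)" for x
      proof -
        have "T * count A x < n + n * k x" unfolding k_def using n by (rule dividend_less_times_div)
        then have "real (T * count A x) < real (n + n * k x)" by (simp only: of_nat_less_iff)
        then show ?thesis using n by (simp add: field_simps)
      qed
      then have "(\<Sum>x\<in>set_mset A. (if x \<in> C then real T * real (count A x) / real n else 0) - 1)
          \<le> (\<Sum>x\<in>set_mset A. if x \<in> C then real (k x) else 0)"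
        by (intro sum_mono) auto
      moreover have "(\<Sum>x\<in>set_mset A. if x \<in> C then real T * real (count A x) / real n else 0)
          = real T * (real (size {#x \<in># A. x \<in> C#}) / real n)"
        unfolding sizeA of_nat_sum sum_divide_distrib sum_distrib_left by (intro sum.cong) auto
      moreover have "(\<Sum>x\<in>set_mset A. if x \<in> C then real (k x) else 0) = real (size {#x \<in># B. x \<in> C#})"
        unfolding sizeB of_nat_sum by (intro sum.cong) auto
      ultimately show ?thesis using A(2) by (simp add: sum_subtractf)
    qed
    have "real T - real N \<le> real (size B)" using lower[of UNIV] A(1) by (simp add: n_def)
    then have Bpos: "0 < size B" using T(1) by linarith
    show "\<exists>B. B \<noteq> {#} \<and> size B \<le> T \<and>
        (\<forall>C. real (size {#x \<in># A. x \<in> C#}) / real (size A) - \<epsilon>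
            \<le> real (size {#x \<in># B. x \<in> C#}) / real (size B))"
    proof (intro exI[of _ B] conjI allI)
      show "B \<noteq> {#}" using Bpos by auto
      show "size B \<le> T" by (rule BT)
      fix C
      have "real (size {#x \<in># A. x \<in> C#}) / real (size A) - \<epsilon>
          \<le> real (size {#x \<in># A. x \<in> C#}) / real n - real N / real T"
        using NT by (simp add: n_def)
      also have "\<dots> = (real T * (real (size {#x \<in># A. x \<in> C#}) / real n) - real N) / real T"
        using T(1) by (simp add: diff_divide_distrib)
      also have "\<dots> \<le> real (size {#x \<in># B. x \<in> C#}) / real T"
        using lower by (intro divide_right_mono) auto
      \<comment> \<open>Only a lower bound is wanted, and replacing \<open>T\<close> by the possibly
        smaller size of \<open>B\<close> increases the quotient.\<close>
      also have "\<dots> \<le> real (size {#x \<in># B. x \<in> C#}) / real (size B)"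
        using BT Bpos by (intro divide_left_mono) auto
      finally show "real (size {#x \<in># A. x \<in> C#}) / real (size A) - \<epsilon>
          \<le> real (size {#x \<in># B. x \<in> C#}) / real (size B)" .
    qed
  qed
qed

section \<open>Choice of parameters and conclusion\<close>

theorem theorem2:
  fixes \<epsilon> :: real
  assumes "0 < \<epsilon>" and "\<epsilon> \<le> 1"
  shows "\<exists>g :: nat. \<forall>P :: (real ^ 'n) set. finite P \<longrightarrow>
           (\<exists>A. one_sided_approximant \<epsilon> P A \<and> size A \<le> g)"
proof -
  obtain \<delta> :: real and r where \<delta>: "0 < \<delta>" and
    stab: "\<forall>Q :: (real ^ 'n) set. finite Q \<longrightarrow>
       (\<exists>a (f :: real ^ 'n \<Rightarrow> ((real ^ 'n) \<times> real) set \<times> ((real ^ 'n) \<times> real) set). card (f ` Q) \<le> r \<and>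
         (\<forall>C. convex C \<longrightarrow> a \<notin> C \<longrightarrow>
           \<delta> * real (card Q) \<le> real (card {x \<in> Q. \<forall>y\<in>Q. f y = f x \<longrightarrow> y \<notin> C})))"
    by (rule stabbing_point[where 'a = "real ^ 'n"]) (rule that)
  \<comment> \<open>Error budget: \<open>\<epsilon> / 2\<close> for rounding,
    \<open>\<epsilon> / 4\<close> for parts of low density and \<open>\<epsilon> / 4\<close> for the
    potential.\<close>
  define \<epsilon>' where "\<epsilon>' = \<epsilon> / 4"
  have \<epsilon>': "0 < \<epsilon>'" using assms by (simp add: \<epsilon>'_def)
  define M where "M = 1 / (\<delta> * \<epsilon>')"
  have M: "0 < M" using \<delta> \<epsilon>' by (simp add: M_def)
  \<comment> \<open>The potential costs at most \<open>M * card P\<close> over all levels together,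
    so on average over \<open>s\<close> levels at most a fraction \<open>M / s\<close>.\<close>
  obtain s :: nat where "M / \<epsilon>' < real s" using reals_Archimedean2 by blast
  then have "M < real s * \<epsilon>'" using \<epsilon>' by (simp add: divide_less_eq)
  moreover from this have s: "0 < real s" using M \<epsilon>' by (metis less_trans zero_less_mult_pos2)
  ultimately have Ms: "M / real s \<le> \<epsilon>'" by (simp add: divide_le_eq mult.commute)
  obtain N where N: "\<forall>Q :: (real ^ 'n) set. finite Q \<longrightarrow>
    (\<exists>A. size A = s * card Q \<and> card (set_mset A) \<le> N \<and>
      (\<forall>C. convex C \<longrightarrow>
        real s * (real (card (C \<inter> Q)) - \<epsilon>' * real (card Q))
          - (real (card Q) - (real (card (C \<inter> Q)))\<^sup>2 / real (card Q)) / (\<delta> * \<epsilon>')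
        \<le> real (size {#x \<in># A. x \<in> C#})))"
    using multiscale_approximant[OF \<delta> \<epsilon>' stab, of s] by (elim exE)
  have "0 < \<epsilon> / 2" using assms by simp
  from bounded_size_rounding[OF this, of N, where 'a = "real ^ 'n"]
  obtain g where g: "\<forall>A :: (real ^ 'n) multiset. A \<noteq> {#} \<longrightarrow> card (set_mset A) \<le> N \<longrightarrow>
    (\<exists>B. B \<noteq> {#} \<and> size B \<le> g \<and>
      (\<forall>C. real (size {#x \<in># A. x \<in> C#}) / real (size A) - \<epsilon> / 2
          \<le> real (size {#x \<in># B. x \<in> C#}) / real (size B)))" by (elim exE)
  show ?thesis
  \<comment> \<open>The maximum with 1 leaves room for the singleton used when \<open>P\<close> is
    empty, where the first quotient is 0.\<close>
  proof (intro exI[of _ "max 1 g"] allI impI)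
    fix P :: "(real ^ 'n) set" assume P: "finite P"
    show "\<exists>A. one_sided_approximant \<epsilon> P A \<and> size A \<le> max 1 g"
    proof (cases "P = {}")
      case True
      then show ?thesis using assms
        by (intro exI[of _ "{#0#}"]) (auto simp: one_sided_approximant_def)
    next
      case False
      define p where "p = real (card P)"
      have p: "0 < p" using P False by (simp add: p_def card_gt_0_iff)
      from N[THEN spec, THEN mp, OF P] obtain A where A: "size A = s * card P" "card (set_mset A) \<le> N"
        and AC: "\<forall>C. convex C \<longrightarrow>
        real s * (real (card (C \<inter> P)) - \<epsilon>' * real (card P))
          - (real (card P) - (real (card (C \<inter> P)))\<^sup>2 / real (card P)) / (\<delta> * \<epsilon>')
        \<le> real (size {#x \<in># A. x \<in> C#})" by (elim exE conjE)
      have sA: "real (size A) = real s * p" by (simp add: A p_def)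
      then have "A \<noteq> {#}" using s p by auto
      from g[THEN spec, THEN mp, THEN mp, OF this A(2)] obtain B where B: "B \<noteq> {#}" "size B \<le> g"
        and BC: "\<forall>C. real (size {#x \<in># A. x \<in> C#}) / real (size A) - \<epsilon> / 2
          \<le> real (size {#x \<in># B. x \<in> C#}) / real (size B)" by (elim exE conjE)
      have "real (card (C \<inter> P)) / real (card P)
          - real (size {#x \<in># B. x \<in> C#}) / real (size B) \<le> \<epsilon>" if C: "convex C" for C
      proof -
        define x where "x = real (card (C \<inter> P))"
        have "real s * (x - \<epsilon>' * p) - (p - x\<^sup>2 / p) * M \<le> real (size {#x \<in># A. x \<in> C#})"
          using AC C by (simp add: x_def p_def M_def)
        moreover have "(p - x\<^sup>2 / p) * M \<le> p * M" using M p by (intro mult_right_mono) auto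
        ultimately have "real s * (x - \<epsilon>' * p) - p * M \<le> real (size {#x \<in># A. x \<in> C#})" by linarith
        then have "(real s * (x - \<epsilon>' * p) - p * M) / (real s * p)
            \<le> real (size {#x \<in># A. x \<in> C#}) / (real s * p)"
          using s p by (intro divide_right_mono) auto
        moreover have "(real s * (x - \<epsilon>' * p) - p * M) / (real s * p) = x / p - \<epsilon>' - M / real s"
          using s p by (simp add: field_simps)
        ultimately have "x / p - \<epsilon>' - M / real s \<le> real (size {#x \<in># A. x \<in> C#}) / real (size A)"
          using sA by simp
        then have "x / p - real (size {#x \<in># B. x \<in> C#}) / real (size B) \<le> \<epsilon> / 2 + \<epsilon>' + M / real s"
          using BC[THEN spec, of C] by linarith
        then show ?thesis using Ms unfolding x_def p_def \<epsilon>'_def by linarith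
      qed
      then show ?thesis using B unfolding one_sided_approximant_def by (intro exI[of _ B]) auto
    qed
  qed
qed

end
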